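(* Let $\alpha \ge 2$ be an integer and let $\tau_{\alpha,\alpha} \in S_{2\alpha}$ be the pattern $[1,2,\dots,\alpha,2\alpha,2\alpha-1,\dots,\alpha+1]$. The packing density of $\tau_{\alpha,\alpha}$ is $$\rho(\tau_{\alpha,\alpha}) = \frac{\binom{2\alpha}{\alpha}}{2^{2\alpha}}.$$
   Context: Permutations are written in one-line notation. For $\sigma \in S_n$ and a pattern $\tau \in S_m$ with $m \le n$, an occurrence of $\tau$ in $\sigma$ is an $m$-subset $S \subseteq \{1,\dots,n\}$ such that the restriction of $\sigma$ to $S$ is order-isomorphic to $\tau$. Let $g(\tau,\sigma)$ be the number of occurrences of $\tau$ in $\sigma$, and let $g(\tau,n) = \max_{\sigma \in S_n} g(\tau,\sigma)$. The sequence $\left(g(\tau,n)/\binom{n}{m}\right)_{n \ge m}$ is known to be nonincreasing in $n$, hence convergent; its limit $\rho(\tau) = \lim_{n\to\infty} g(\tau,n)/\binom{n}{m}$ is called the packing density of $\tau$. *)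

theory Defs
  imports "HOL-Analysis.Analysis" "HOL-Combinatorics.Combinatorics"
begin

text \<open>
  The symmetric group on \<open>n\<close> letters is the set of all \<open>\<sigma>\<close> with \<open>\<sigma> permutes {1..n}\<close>.
  The function \<open>one_line xs\<close> is the permutation of \<open>{1..length xs}\<close> with one-line notation \<open>xs\<close>;
  like every permutation of \<open>{1..n}\<close> in the library, it is the identity elsewhere.
\<close>

definition one_line :: "nat list \<Rightarrow> nat \<Rightarrow> nat" where
  "one_line xs i = (if i \<in> {1..length xs} then xs ! (i - 1) else i)"

lemma one_line_permutes:
  assumes "distinct xs" "set xs = {1..length xs}"
  shows "one_line xs permutes {1..length xs}"
proof (rule bij_imp_permutes)
  have "bij_betw (\<lambda>i. i - 1) {1..length xs} {..<length xs}"
    by (rule bij_betwI[where g = Suc]) auto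
  moreover have "bij_betw ((!) xs) {..<length xs} {1..length xs}"
    using assms by (intro bij_betw_nth) auto
  ultimately have "bij_betw ((!) xs \<circ> (\<lambda>i. i - 1)) {1..length xs} {1..length xs}"
    by (rule bij_betw_trans)
  then show "bij_betw (one_line xs) {1..length xs} {1..length xs}"
    by (rule bij_betw_cong[THEN iffD1, rotated]) (auto simp: one_line_def)
qed (auto simp: one_line_def)

text \<open>
  The restriction of \<open>\<sigma>\<close> to an \<open>m\<close>-set \<open>S\<close> of positions is order-isomorphic to \<open>\<tau>\<close>:
  the increasing bijection \<open>f\<close> from \<open>{1..m}\<close> onto \<open>S\<close> transports the relative order of the values.
\<close>

definition order_iso_restr :: "nat \<Rightarrow> (nat \<Rightarrow> nat) \<Rightarrow> (nat \<Rightarrow> nat) \<Rightarrow> nat set \<Rightarrow> bool" where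
  "order_iso_restr m \<tau> \<sigma> S \<longleftrightarrow>
     (\<exists>f. strict_mono_on {1..m} f \<and> f ` {1..m} = S \<and>
          (\<forall>i\<in>{1..m}. \<forall>j\<in>{1..m}. \<sigma> (f i) < \<sigma> (f j) \<longleftrightarrow> \<tau> i < \<tau> j))"

definition occurrences :: "nat \<Rightarrow> (nat \<Rightarrow> nat) \<Rightarrow> nat \<Rightarrow> (nat \<Rightarrow> nat) \<Rightarrow> nat set set" where
  "occurrences m \<tau> n \<sigma> = {S. S \<subseteq> {1..n} \<and> card S = m \<and> order_iso_restr m \<tau> \<sigma> S}"

definition num_occ :: "nat \<Rightarrow> (nat \<Rightarrow> nat) \<Rightarrow> nat \<Rightarrow> (nat \<Rightarrow> nat) \<Rightarrow> nat" where
  "num_occ m \<tau> n \<sigma> = card (occurrences m \<tau> n \<sigma>)"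

definition max_occ :: "nat \<Rightarrow> (nat \<Rightarrow> nat) \<Rightarrow> nat \<Rightarrow> nat" where
  "max_occ m \<tau> n = Max (num_occ m \<tau> n ` {\<sigma>. \<sigma> permutes {1..n}})"

definition packing_ratio :: "nat \<Rightarrow> (nat \<Rightarrow> nat) \<Rightarrow> nat \<Rightarrow> real" where
  "packing_ratio m \<tau> n = real (max_occ m \<tau> n) / real (n choose m)"

definition packing_density :: "nat \<Rightarrow> (nat \<Rightarrow> nat) \<Rightarrow> real" where
  "packing_density m \<tau> = lim (packing_ratio m \<tau>)"

definition tau_diag :: "nat \<Rightarrow> nat \<Rightarrow> nat" where
  "tau_diag \<alpha> = one_line ([1..<\<alpha> + 1] @ rev [\<alpha> + 1..<2 * \<alpha> + 1])"

lemma tau_diag_permutes: "tau_diag \<alpha> permutes {1..2 * \<alpha>}"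
proof -
  let ?xs = "[1..<\<alpha> + 1] @ rev [\<alpha> + 1..<2 * \<alpha> + 1]"
  have len: "length ?xs = 2 * \<alpha>" by simp
  have "one_line ?xs permutes {1..length ?xs}"
    by (rule one_line_permutes) (auto simp: len)
  then show ?thesis by (simp only: len tau_diag_def)
qed

text \<open>
  The limit in \<open>packing_density\<close> exists: the packing ratio is nonincreasing from \<open>m\<close> on,
  by averaging over the deletion of one position of an optimal permutation.
\<close>

lemma finite_occurrences: "finite (occurrences m \<tau> n \<sigma>)"
  by (rule finite_subset[of _ "Pow {1..n}"]) (auto simp: occurrences_def)

lemma num_occ_le_max_occ:
  assumes "\<sigma> permutes {1..n}"
  shows "num_occ m \<tau> n \<sigma> \<le> max_occ m \<tau> n"
  unfolding max_occ_def using assms by (intro Max_ge) (auto simp: finite_permutations)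

lemma max_occ_attained:
  obtains \<sigma> where "\<sigma> permutes {1..n}" "num_occ m \<tau> n \<sigma> = max_occ m \<tau> n"
proof -
  have "{\<sigma>. \<sigma> permutes {1..n}} \<noteq> {}" using permutes_id[of "{1..n}"] by blast
  then have "max_occ m \<tau> n \<in> num_occ m \<tau> n ` {\<sigma>. \<sigma> permutes {1..n}}"
    unfolding max_occ_def by (intro Max_in) (auto simp: finite_permutations)
  then show ?thesis using that by auto
qed

lemma card_occurrences_avoiding:
  assumes \<sigma>: "\<sigma> permutes {1..Suc n}" and p: "p \<in> {1..Suc n}"
  shows "card {S \<in> occurrences m \<tau> (Suc n) \<sigma>. p \<notin> S} \<le> max_occ m \<tau> n"
proof -
  define d where "d i = (if i < p then i else Suc i)" for i
  define c where "c i = (if i < p then i else i - 1)" for i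
  define q where "q = \<sigma> p"
  define e where "e v = (if v < q then v else v - 1)" for v :: nat
  define \<sigma>' where "\<sigma>' i = (if i \<in> {1..n} then e (\<sigma> (d i)) else i)" for i
  have q: "q \<in> {1..Suc n}" using \<sigma> p unfolding q_def by (simp only: permutes_in_image)
  have d: "bij_betw d {1..n} ({1..Suc n} - {p})"
    by (rule bij_betwI[where g = c]) (use p in \<open>auto simp: d_def c_def split: if_splits\<close>)
  have e: "bij_betw e ({1..Suc n} - {q}) {1..n}"
    by (rule bij_betwI[where g = "\<lambda>v. if v < q then v else Suc v"]) (use q in \<open>auto simp: e_def split: if_splits\<close>)
  have s: "bij_betw \<sigma> ({1..Suc n} - {p}) ({1..Suc n} - {q})"
    unfolding q_def using permutes_imp_bij[OF \<sigma>] p by (intro bij_betw_DiffI) (auto simp: bij_betw_def)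
  have "bij_betw (e \<circ> (\<sigma> \<circ> d)) {1..n} {1..n}"
    by (intro bij_betw_trans[OF bij_betw_trans[OF d s] e])
  then have "bij_betw \<sigma>' {1..n} {1..n}"
    by (rule bij_betw_cong[THEN iffD1, rotated]) (auto simp: \<sigma>'_def)
  then have \<sigma>': "\<sigma>' permutes {1..n}"
    by (rule bij_imp_permutes) (auto simp: \<sigma>'_def)
  have e_less: "e u < e v \<longleftrightarrow> u < v" if "u \<noteq> q" "v \<noteq> q" for u v
    using that by (auto simp: e_def)
  have "{S \<in> occurrences m \<tau> (Suc n) \<sigma>. p \<notin> S} \<subseteq> (`) d ` occurrences m \<tau> n \<sigma>'"
  proof
    fix S assume "S \<in> {S \<in> occurrences m \<tau> (Suc n) \<sigma>. p \<notin> S}"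
    then have S: "S \<subseteq> {1..Suc n}" "card S = m" "p \<notin> S" and "order_iso_restr m \<tau> \<sigma> S"
      by (auto simp: occurrences_def)
    then obtain f where f: "strict_mono_on {1..m} f" "f ` {1..m} = S"
      "\<forall>i\<in>{1..m}. \<forall>j\<in>{1..m}. \<sigma> (f i) < \<sigma> (f j) \<longleftrightarrow> \<tau> i < \<tau> j"
      unfolding order_iso_restr_def by blast
    have fS: "f i \<in> {1..Suc n}" "f i \<noteq> p" if "i \<in> {1..m}" for i
      using f(2) S that by blast+
    have dc: "d (c x) = x" if "x \<noteq> p" for x
      using that by (auto simp: d_def c_def)
    have c_less: "c x < c y" if "x \<noteq> p" "y \<noteq> p" "x < y" for x y
      using that by (auto simp: c_def)
    have c_in: "c x \<in> {1..n}" if "x \<in> {1..Suc n}" "x \<noteq> p" for x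
      using that p by (auto simp: c_def)
    have S_eq: "d ` c ` S = S"
      unfolding image_image using dc S(3) by (force simp: image_iff)
    have "inj_on c S"
      using S(3) by (metis dc inj_onI)
    then have card: "card (c ` S) = m"
      using S(2) by (simp add: card_image)
    have sub: "c ` S \<subseteq> {1..n}"
      using c_in S by blast
    have \<sigma>'c: "\<sigma>' (c x) = e (\<sigma> x)" if "x \<in> {1..Suc n}" "x \<noteq> p" for x
      using c_in[OF that] dc[OF that(2)] by (simp add: \<sigma>'_def)
    have neq: "\<sigma> x \<noteq> q" if "x \<noteq> p" for x
      using that permutes_inj[OF \<sigma>] by (auto simp: q_def dest: injD)
    have "order_iso_restr m \<tau> \<sigma>' (c ` S)"
      unfolding order_iso_restr_def
    proof (intro exI[of _ "c \<circ> f"] conjI ballI)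
      show "strict_mono_on {1..m} (c \<circ> f)"
        using f(1) fS by (auto simp: strict_mono_on_def intro!: c_less)
      show "(c \<circ> f) ` {1..m} = c ` S"
        using f(2) by (simp only: image_comp[symmetric])
      fix i j assume ij: "i \<in> {1..m}" "j \<in> {1..m}"
      show "\<sigma>' ((c \<circ> f) i) < \<sigma>' ((c \<circ> f) j) \<longleftrightarrow> \<tau> i < \<tau> j"
        unfolding o_def \<sigma>'c[OF fS[OF ij(1)]] \<sigma>'c[OF fS[OF ij(2)]]
          e_less[OF neq[OF fS(2)[OF ij(1)]] neq[OF fS(2)[OF ij(2)]]]
        using f(3) ij by blast
    qed
    then have "c ` S \<in> occurrences m \<tau> n \<sigma>'"
      using card sub by (simp add: occurrences_def)
    then show "S \<in> (`) d ` occurrences m \<tau> n \<sigma>'"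
      by (intro image_eqI[where x = "c ` S"]) (simp_all only: S_eq)
  qed
  then have "card {S \<in> occurrences m \<tau> (Suc n) \<sigma>. p \<notin> S} \<le> num_occ m \<tau> n \<sigma>'"
    unfolding num_occ_def by (rule surj_card_le[OF finite_occurrences])
  also have "\<dots> \<le> max_occ m \<tau> n" by (rule num_occ_le_max_occ[OF \<sigma>'])
  finally show ?thesis .
qed

lemma max_occ_Suc: "max_occ m \<tau> (Suc n) * (Suc n - m) \<le> Suc n * max_occ m \<tau> n"
proof -
  obtain \<sigma> where \<sigma>: "\<sigma> permutes {1..Suc n}" "num_occ m \<tau> (Suc n) \<sigma> = max_occ m \<tau> (Suc n)"
    by (rule max_occ_attained)
  let ?O = "occurrences m \<tau> (Suc n) \<sigma>"
  have "max_occ m \<tau> (Suc n) * (Suc n - m) = (\<Sum>S\<in>?O. card {p \<in> {1..Suc n}. p \<notin> S})"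
  proof -
    have "card {p \<in> {1..Suc n}. p \<notin> S} = Suc n - m" if "S \<in> ?O" for S
    proof -
      have S: "S \<subseteq> {1..Suc n}" "card S = m" using that by (auto simp: occurrences_def)
      have "{p \<in> {1..Suc n}. p \<notin> S} = {1..Suc n} - S" by auto
      then show ?thesis
        using S card_Diff_subset[of S "{1..Suc n}"] finite_subset[OF S(1)] by simp
    qed
    then show ?thesis using \<sigma>(2) by (simp add: num_occ_def)
  qed
  also have "\<dots> = (\<Sum>p\<in>{1..Suc n}. card {S \<in> ?O. p \<notin> S})"
    by (rule sum_multicount_gen[OF finite_atLeastAtMost finite_occurrences, symmetric]) simp
  also have "\<dots> \<le> (\<Sum>p\<in>{1..Suc n}. max_occ m \<tau> n)"
    by (rule sum_mono) (rule card_occurrences_avoiding[OF \<sigma>(1)])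
  finally show ?thesis by simp
qed

lemma packing_ratio_Suc_le:
  assumes "m \<le> n"
  shows "packing_ratio m \<tau> (Suc n) \<le> packing_ratio m \<tau> n"
proof -
  have bin: "(Suc n - m) * (Suc n choose m) = Suc n * (n choose m)"
    using binomial_absorb_comp[of "Suc n" m] by simp
  have pos: "0 < (n choose m)" "0 < (Suc n choose m)"
    using assms by simp_all
  have "max_occ m \<tau> (Suc n) * (n choose m) * Suc n
      = max_occ m \<tau> (Suc n) * (Suc n - m) * (Suc n choose m)"
    using bin by (metis mult.assoc mult.commute)
  also have "\<dots> \<le> Suc n * max_occ m \<tau> n * (Suc n choose m)"
    by (rule mult_right_mono[OF max_occ_Suc]) simp
  finally have "max_occ m \<tau> (Suc n) * (n choose m) \<le> max_occ m \<tau> n * (Suc n choose m)"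
    by (metis Suc_mult_le_cancel1 mult.assoc mult.commute)
  then have "real (max_occ m \<tau> (Suc n)) * real (n choose m)
      \<le> real (max_occ m \<tau> n) * real (Suc n choose m)"
    by (metis of_nat_le_iff of_nat_mult)
  then show ?thesis
    using pos unfolding packing_ratio_def by (subst frac_le_eq) (auto simp: divide_simps)
qed

lemma packing_ratio_tendsto: "packing_ratio m \<tau> \<longlonglongrightarrow> packing_density m \<tau>"
proof -
  have "decseq (\<lambda>n. packing_ratio m \<tau> (n + m))"
    by (rule decseq_SucI) (simp add: packing_ratio_Suc_le)
  moreover have "0 \<le> packing_ratio m \<tau> (n + m)" for n
    by (simp add: packing_ratio_def)
  ultimately obtain L where "(\<lambda>n. packing_ratio m \<tau> (n + m)) \<longlonglongrightarrow> L"
    using decseq_convergent[of "\<lambda>n. packing_ratio m \<tau> (n + m)" 0] by blast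
  then have "packing_ratio m \<tau> \<longlonglongrightarrow> L" by (rule LIMSEQ_offset)
  then show ?thesis unfolding packing_density_def using limI by blast
qed

end

theory Submission
  imports Defs "HOL-Computational_Algebra.Formal_Power_Series" "HOL-Library.Sublist"
begin

text \<open>
  Give the points of a permutation nonnegative weights and inflate each of them to a decreasing
  run of that weight. If \<open>x, y\<close> is an adjacent descent, an occurrence never uses one of them in its
  increasing part together with the other, and where the decreasing part may use both, only the
  total weight of the two matters. Hence the weighted number of occurrences is a convex function of
  the way this total weight is split, and one of the two points can be dropped. This reduces the
  upper bound to increasing permutations with weights \<open>w\<^sub>1, \<dots>, w\<^sub>r\<close>, where \<open>(\<alpha>!)\<^sup>2\<close> times the
  count is \<open>\<alpha>! \<Sum>\<^sub>i e\<^sub>\<alpha>(w\<^sub>1, \<dots>, w\<^bsub>i-1\<^esub>) w\<^sub>i\<^sup>\<alpha>\<close>. Induction on \<open>r\<close> bounds this by \<open>(s\<^sup>2/4)\<^sup>\<alpha>\<close> with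
  \<open>s = \<Sum>\<^sub>i w\<^sub>i\<close>: if the last weight is at most half of the sum of the others, the bound for the
  others is good enough; otherwise one plays the repeated letters missing in \<open>e\<^sub>\<alpha>\<close> against the
  terms with \<open>i < r\<close>. The pattern \<open>tau_diag k\<close> itself shows that the bound is asymptotically attained.
\<close>

section \<open>Tangent-line bounds for differences of powers\<close>

lemma power_diff_le:
  fixes p q :: real
  assumes "0 \<le> q" "q \<le> p"
  shows "p ^ Suc n - q ^ Suc n \<le> real (Suc n) * p ^ n * (p - q)"
proof (induction n)
  case (Suc n)
  have "p ^ Suc (Suc n) - q ^ Suc (Suc n) = p * (p ^ Suc n - q ^ Suc n) + q ^ Suc n * (p - q)"
    by (simp add: algebra_simps)
  also have "\<dots> \<le> p * (real (Suc n) * p ^ n * (p - q)) + p ^ Suc n * (p - q)"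
    using assms Suc by (intro add_mono mult_left_mono mult_right_mono power_mono) auto
  finally show ?case by (simp add: algebra_simps)
qed simp

lemma power_diff_ge:
  fixes p q :: real
  assumes "0 \<le> q" "q \<le> p"
  shows "real (Suc n) * q ^ n * (p - q) \<le> p ^ Suc n - q ^ Suc n"
proof (induction n)
  case (Suc n)
  have "real (Suc (Suc n)) * q ^ Suc n * (p - q) = q * (real (Suc n) * q ^ n * (p - q)) + q ^ Suc n * (p - q)"
    by (simp add: algebra_simps)
  also have "\<dots> \<le> q * (p ^ Suc n - q ^ Suc n) + p ^ Suc n * (p - q)"
    using assms Suc by (intro add_mono mult_left_mono mult_right_mono power_mono) auto
  finally show ?case by (simp add: algebra_simps)
qed simp

section \<open>Generating functions of weighted up-down words\<close>

text \<open>
  Lists are read as one-line notations, and each letter \<open>z\<close> is inflated to a decreasing run of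
  total weight \<open>w z\<close>. So \<open>desc_gf\<close> is an exponential generating function: \<open>n!\<close> times its
  \<open>n\<close>-th coefficient is the weight of all words of length \<open>n\<close> whose distinct letters form a
  decreasing subsequence. In \<open>up_gf m w k\<close> such words of length \<open>m\<close> are preceded by \<open>k\<close>
  increasing letters, all smaller than everything after them.
\<close>

function desc_gf :: "('a::linorder \<Rightarrow> real) \<Rightarrow> 'a list \<Rightarrow> real fps" where
  "desc_gf w [] = 1"
| "desc_gf w (z # L) = desc_gf w L + (fps_exp (w z) - 1) * desc_gf w (filter (\<lambda>y. y < z) L)"
  by pat_completeness auto
termination by (relation "Wellfounded.measure (\<lambda>(w, L). length L)") (auto simp: less_Suc_eq_le)

fun up_gf :: "nat \<Rightarrow> ('a::linorder \<Rightarrow> real) \<Rightarrow> nat \<Rightarrow> 'a list \<Rightarrow> real" where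
  "up_gf m w 0 L = fps_nth (desc_gf w L) m"
| "up_gf m w (Suc k) [] = 0"
| "up_gf m w (Suc k) (z # L) = up_gf m w (Suc k) L + w z * up_gf m w k (filter (\<lambda>y. z < y) L)"

lemma desc_gf_cong:
  assumes "\<And>z. z \<in> set L \<Longrightarrow> w z = w' z"
  shows "desc_gf w L = desc_gf w' L"
  using assms by (induction w L rule: desc_gf.induct) auto

lemma up_gf_cong:
  assumes "\<And>z. z \<in> set L \<Longrightarrow> w z = w' z"
  shows "up_gf m w k L = up_gf m w' k L"
  using assms
proof (induction m w k L rule: up_gf.induct)
  case (1 m w L)
  then show ?case using desc_gf_cong[of L w w'] by simp
qed auto

lemma fps_mult_nonneg:
  fixes f g :: "real fps"
  assumes "\<And>i. 0 \<le> fps_nth f i" "\<And>i. 0 \<le> fps_nth g i"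
  shows "0 \<le> fps_nth (f * g) k"
  by (simp add: fps_mult_nth assms sum_nonneg)

lemma fps_exp_minus_one_nonneg: "0 \<le> a \<Longrightarrow> 0 \<le> fps_nth (fps_exp a - 1) i" for a :: real
  by (cases i) auto

lemma desc_gf_nonneg:
  assumes "\<And>z. z \<in> set L \<Longrightarrow> 0 \<le> w z"
  shows "0 \<le> fps_nth (desc_gf w L) k"
  using assms
proof (induction w L arbitrary: k rule: desc_gf.induct)
  case (2 w z L)
  then show ?case
    by (auto intro!: add_nonneg_nonneg fps_mult_nonneg fps_exp_minus_one_nonneg)
qed auto

text \<open>Deleting letters only removes words, and all words have nonnegative weight. In
  \<open>convex_desc_gf\<close> this makes a difference of two such series coefficientwise
  nonnegative.\<close>

lemma desc_gf_mono_filter: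
  assumes "\<And>z. z \<in> set L \<Longrightarrow> 0 \<le> w z"
  shows "fps_nth (desc_gf w (filter P L)) k \<le> fps_nth (desc_gf w L) k"
  using assms
proof (induction w L arbitrary: k rule: desc_gf.induct)
  case (2 w z L)
  have nn: "0 \<le> fps_nth ((fps_exp (w z) - 1) * desc_gf w (filter (\<lambda>y. y < z) L)) k"
    using 2(3) by (intro fps_mult_nonneg fps_exp_minus_one_nonneg desc_gf_nonneg) auto
  show ?case
  proof (cases "P z")
    case True
    have "fps_nth ((fps_exp (w z) - 1) * desc_gf w (filter P (filter (\<lambda>y. y < z) L))) k
       \<le> fps_nth ((fps_exp (w z) - 1) * desc_gf w (filter (\<lambda>y. y < z) L)) k"
      unfolding fps_mult_nth using 2(3)
      by (intro sum_mono mult_left_mono 2(2) fps_exp_minus_one_nonneg) auto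
    then show ?thesis using True 2(1)[of k] 2(3)
      by (simp add: filter_filter conj_commute)
  next
    case False
    then show ?thesis using 2(1)[of k] 2(3) nn by simp
  qed
qed auto

lemma desc_gf_filter_support: "desc_gf w (filter (\<lambda>z. w z \<noteq> 0) L) = desc_gf w L"
proof (induction w L rule: desc_gf.induct)
  case (2 w z L)
  then show ?case by (simp add: filter_filter conj_commute)
qed simp

text \<open>A letter enters only through a factor \<open>w z\<close> or
  \<open>fps_exp (w z) - 1\<close>, and both vanish at weight zero. This is how a point is dropped
  once its weight has been shifted away.\<close>

lemma up_gf_filter_support: "up_gf m w k (filter (\<lambda>z. w z \<noteq> 0) L) = up_gf m w k L"
proof (induction m w k L rule: up_gf.induct)
  case (3 m w k z L)
  then show ?case by (simp add: filter_filter conj_commute)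
qed (simp_all add: desc_gf_filter_support)

section \<open>Convexity in the weight split of an adjacent descent\<close>

lemma convex_on_power_nonneg: "convex_on {0::real..} (\<lambda>t. t ^ n)"
  by (cases "even n") (auto intro: convex_power_odd convex_on_subset[OF convex_power_even])

lemma convex_on_reflect:
  fixes f :: "real \<Rightarrow> real"
  assumes "convex_on {0..c} f"
  shows "convex_on {0..c} (\<lambda>t. f (c - t))"
proof (rule convex_onI)
  fix t x y :: real
  assume "0 < t" "t < 1" "x \<in> {0..c}" "y \<in> {0..c}"
  moreover have "c - ((1 - t) *\<^sub>R x + t *\<^sub>R y) = (1 - t) *\<^sub>R (c - x) + t *\<^sub>R (c - y)"
    by (simp add: algebra_simps)
  ultimately show "f (c - ((1 - t) *\<^sub>R x + t *\<^sub>R y)) \<le> (1 - t) * f (c - x) + t * f (c - y)"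
    using convex_onD[OF assms, of t "c - x" "c - y"] by simp
qed auto

lemma convex_on_sum_fun:
  assumes "finite I" "convex S" "\<And>i. i \<in> I \<Longrightarrow> convex_on S (f i)"
  shows "convex_on S (\<lambda>t. \<Sum>i\<in>I. f i t :: real)"
  using assms(1,3,2) by (induction I rule: finite_induct) (auto simp: convex_on_const)

lemma convex_on_cmul_right:
  "0 \<le> c \<Longrightarrow> convex_on S f \<Longrightarrow> convex_on S (\<lambda>x. f x * c)" for c :: real
  using convex_on_cmul[of c S f] by (simp add: mult.commute)

text \<open>The coefficients \<open>t ^ i / fact i\<close> of \<open>fps_exp t\<close> are convex
  for nonnegative \<open>t\<close>, and multiplying by \<open>D\<close> takes nonnegative
  combinations of them.\<close>

lemma convex_on_fps_exp_mult:
  assumes "\<And>i. 0 \<le> fps_nth D i"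
  shows "convex_on {0..c} (\<lambda>t. fps_nth ((fps_exp t - 1) * D) k)"
  unfolding fps_mult_nth
proof (intro convex_on_sum_fun convex_on_cmul_right assms)
  fix i
  have "convex_on {0..c} (\<lambda>t. (1 / fact i) * t ^ i + - fps_nth 1 i)"
    by (intro convex_on_add convex_on_cmul convex_on_subset[OF convex_on_power_nonneg])
      (auto simp: convex_on_const)
  then show "convex_on {0..c} (\<lambda>t. fps_nth (fps_exp t - 1) i)"
    by simp
qed auto

text \<open>For distinct \<open>x\<close> and \<open>y\<close> this family keeps their total weight
  fixed. It passes through \<open>w\<close> at \<open>t = w x\<close>, and at \<open>t = 0\<close>
  and \<open>t = w x + w y\<close> one of the two weights vanishes.\<close>

definition shift_weight :: "('a \<Rightarrow> real) \<Rightarrow> 'a \<Rightarrow> 'a \<Rightarrow> real \<Rightarrow> 'a \<Rightarrow> real" where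
  "shift_weight w x y t = w(x := t, y := w x + w y - t)"

text \<open>The middle block may have lost \<open>x\<close>, \<open>y\<close> or both, so that the
  property survives the filters in the recursions of \<open>desc_gf\<close> and
  \<open>up_gf\<close>.\<close>

definition adjacent_in :: "'a \<Rightarrow> 'a \<Rightarrow> 'a list \<Rightarrow> bool" where
  "adjacent_in x y L \<longleftrightarrow> (\<exists>P M Q. L = P @ M @ Q \<and> M \<in> {[], [x], [y], [x, y]} \<and>
     {x, y} \<inter> (set P \<union> set Q) = {})"

lemma adjacent_in_filter:
  assumes "adjacent_in x y L"
  shows "adjacent_in x y (filter R L)"
proof -
  obtain P M Q where *: "L = P @ M @ Q" "M \<in> {[], [x], [y], [x, y]}"
    "{x, y} \<inter> (set P \<union> set Q) = {}"
    using assms by (auto simp: adjacent_in_def)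
  have "filter R M \<in> {[], [x], [y], [x, y]}" using *(2) by (cases "R x"; cases "R y") auto
  then show ?thesis
    unfolding adjacent_in_def using * by (intro exI[of _ "filter R P"] exI[of _ "filter R M"] exI[of _ "filter R Q"]) auto
qed

lemma adjacent_in_Cons_cases:
  assumes "adjacent_in x y (z # L)"
  obtains "z \<noteq> x" "z \<noteq> y" "adjacent_in x y L"
  | "z = x" "x \<notin> set L" "y \<notin> set L"
  | "z = y" "x \<notin> set L" "y \<notin> set L"
  | Q where "z = x" "L = y # Q" "x \<notin> set Q" "y \<notin> set Q"
proof -
  obtain P M Q where *: "z # L = P @ M @ Q" "M \<in> {[], [x], [y], [x, y]}"
    "{x, y} \<inter> (set P \<union> set Q) = {}"
    using assms by (auto simp: adjacent_in_def)
  show ?thesis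
  proof (cases P)
    case Nil
    show ?thesis
    proof (cases "M = []")
      case True
      then have "adjacent_in x y L" using * Nil
        unfolding adjacent_in_def by (intro exI[of _ "[]"] exI[of _ "[]"] exI[of _ L]) auto
      then show ?thesis using that(1) * Nil True by auto
    next
      case False
      then show ?thesis using * Nil that(2-4) by auto
    qed
  next
    case (Cons a P')
    then have "adjacent_in x y L" using *
      unfolding adjacent_in_def by (intro exI[of _ P'] exI[of _ M] exI[of _ Q]) auto
    then show ?thesis using that(1) * Cons by auto
  qed
qed

lemma desc_gf_shift_weight:
  "x \<notin> set L \<Longrightarrow> y \<notin> set L \<Longrightarrow> desc_gf (shift_weight w x y t) L = desc_gf w L"
  by (rule desc_gf_cong) (auto simp: shift_weight_def)

lemma up_gf_shift_weight:
  "x \<notin> set L \<Longrightarrow> y \<notin> set L \<Longrightarrow> up_gf m (shift_weight w x y t) k L = up_gf m w k L"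
  by (rule up_gf_cong) (auto simp: shift_weight_def)

text \<open>Induction along the recursion. A head outside the pair keeps its weight; a lone
  \<open>x\<close> or \<open>y\<close> contributes an exponential in \<open>t\<close> or in
  \<open>w x + w y - t\<close>; the case \<open>x # y # Q\<close> is settled by an explicit
  formula.\<close>

lemma convex_desc_gf:
  assumes "y < x" "adjacent_in x y L" "\<And>z. 0 \<le> w z"
  shows "convex_on {0..w x + w y} (\<lambda>t. fps_nth (desc_gf (shift_weight w x y t) L) k)"
  using assms(2)
proof (induction L arbitrary: k rule: length_induct)
  case (1 L)
  let ?c = "w x + w y"
  let ?u = "shift_weight w x y"
  have nn: "0 \<le> fps_nth (desc_gf w L') i" for L' i
    by (rule desc_gf_nonneg) (rule assms(3))
  show ?case
  proof (cases L)
    case Nil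
    then show ?thesis by (simp add: convex_on_const)
  next
    case (Cons z L')
    from 1(2)[unfolded Cons] show ?thesis
    proof (cases rule: adjacent_in_Cons_cases)
      case 1
      have len: "length (filter (\<lambda>y. y < z) L') < length L"
        using Cons by (simp add: less_Suc_eq_le)
      have uz: "?u t z = w z" for t using 1 by (simp add: shift_weight_def)
      have IH1: "convex_on {0..?c} (\<lambda>t. fps_nth (desc_gf (?u t) L') i)" for i
        using "1.IH" Cons 1 by simp
      have IH2: "convex_on {0..?c} (\<lambda>t. fps_nth (desc_gf (?u t) (filter (\<lambda>y. y < z) L')) i)" for i
        using "1.IH" len adjacent_in_filter[OF 1(3)] by blast
      show ?thesis
        unfolding Cons desc_gf.simps fps_add_nth fps_mult_nth uz
        by (intro convex_on_add IH1 convex_on_sum_fun convex_on_cmul IH2 fps_exp_minus_one_nonneg assms(3)) auto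
    next
      case 2
      have "convex_on {0..?c} (\<lambda>t. fps_nth (desc_gf w L') k
          + fps_nth ((fps_exp t - 1) * desc_gf w (filter (\<lambda>y. y < z) L')) k)"
        by (intro convex_on_add convex_on_fps_exp_mult nn) (simp add: convex_on_const)
      moreover have "?u t x = t" for t using less_imp_neq[OF assms(1)] by (simp add: shift_weight_def)
      ultimately show ?thesis using 2 Cons by (simp add: desc_gf_shift_weight)
    next
      case 3
      have "convex_on {0..?c} (\<lambda>t. fps_nth (desc_gf w L') k
          + fps_nth ((fps_exp (?c - t) - 1) * desc_gf w (filter (\<lambda>y. y < z) L')) k)"
        by (intro convex_on_add convex_on_reflect[OF convex_on_fps_exp_mult] nn) (simp add: convex_on_const)
      moreover have "?u t y = ?c - t" for t by (simp add: shift_weight_def)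
      ultimately show ?thesis using 3 Cons by (simp add: desc_gf_shift_weight)
    next
      case (4 Q)
      let ?D = "desc_gf w Q" and ?Dx = "desc_gf w (filter (\<lambda>v. v < x) Q)"
        and ?Dy = "desc_gf w (filter (\<lambda>v. v < y) Q)"
      have ff: "filter (\<lambda>v. v < y) (filter (\<lambda>v. v < x) Q) = filter (\<lambda>v. v < y) Q"
        using assms(1) by (auto simp: filter_filter intro!: filter_cong)
      have u: "?u t x = t" "?u t y = ?c - t" for t using less_imp_neq[OF assms(1)] by (auto simp: shift_weight_def)
      \<comment> \<open>Since \<open>fps_exp t * fps_exp (?c - t) = fps_exp ?c\<close>, words whose
        continuation lies below \<open>y\<close> see only the total weight; \<open>t\<close> remains
        only with continuations below \<open>x\<close> but not entirely below
        \<open>y\<close>.\<close>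
      have eq: "desc_gf (?u t) L = ?D + (fps_exp t - 1) * (?Dx - ?Dy) + (fps_exp ?c - 1) * ?Dy" for t
      proof -
        have "fps_exp t * fps_exp (?c - t) = (fps_exp ?c :: real fps)"
          unfolding fps_exp_add_mult[symmetric] by simp
        moreover have "desc_gf (?u t) L = ?D + (fps_exp (?c - t) - 1) * ?Dy
            + (fps_exp t - 1) * (?Dx + (fps_exp (?c - t) - 1) * ?Dy)"
          using 4 Cons assms(1) by (simp add: desc_gf_shift_weight u ff del: filter_filter)
        ultimately show ?thesis
          by (simp add: algebra_simps)
      qed
      have "0 \<le> fps_nth (?Dx - ?Dy) i" for i
        using desc_gf_mono_filter[of "filter (\<lambda>v. v < x) Q" w "\<lambda>v. v < y" i] assms(3) ff by simp
      then show ?thesis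
        unfolding eq fps_add_nth by (intro convex_on_add convex_on_fps_exp_mult) (auto simp: convex_on_const)
    qed
  qed
qed

lemma convex_on_affine: "convex_on {0..c} (\<lambda>t. a + t * b)" for a b c :: real
  by (rule convex_onI) (auto simp: algebra_simps)

text \<open>After \<open>x\<close> is taken as an increasing letter, the filter removes the smaller
  \<open>y\<close>; after \<open>y\<close> is taken, \<open>x\<close> has already been passed. So
  while choosing an increasing letter from the pair the dependence on \<open>t\<close> is affine,
  and the decreasing part is \<open>convex_desc_gf\<close>.\<close>

lemma convex_up_gf:
  assumes "y < x" "adjacent_in x y L" "\<And>z. 0 \<le> w z"
  shows "convex_on {0..w x + w y} (\<lambda>t. up_gf m (shift_weight w x y t) k L)"
  using assms(2,3)
proof (induction m w k L rule: up_gf.induct)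
  case (1 m w L)
  then show ?case using convex_desc_gf[OF assms(1)] by simp
next
  case (2 m w k)
  then show ?case by (simp add: convex_on_const)
next
  case (3 m w k z L)
  let ?c = "w x + w y" and ?u = "shift_weight w x y"
  let ?a = "up_gf m w (Suc k) L" and ?b = "\<lambda>z. up_gf m w k (filter ((<) z) L)"
  have u: "?u t x = t" "?u t y = ?c - t" for t
    using less_imp_neq[OF assms(1)] by (auto simp: shift_weight_def)
  from 3(3) show ?case
  proof (cases rule: adjacent_in_Cons_cases)
    case 1
    have "?u t z = w z" for t using 1 by (simp add: shift_weight_def)
    then show ?thesis
      using 3(1)[OF 1(3) 3(4)] 3(2)[OF adjacent_in_filter[OF 1(3)] 3(4)] 3(4)
      by (auto intro!: convex_on_add convex_on_cmul)
  next
    case 2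
    then show ?thesis
      using convex_on_affine[of ?c ?a "?b x"] by (simp add: up_gf_shift_weight u)
  next
    case c: 3
    then show ?thesis
      using convex_on_reflect[OF convex_on_affine[of ?c ?a "?b y"]] by (simp add: up_gf_shift_weight u)
  next
    case (4 Q)
    let ?q = "\<lambda>z. up_gf m w k (filter ((<) z) Q)"
    have "convex_on {0..?c} (\<lambda>t. up_gf m w (Suc k) Q + (?c - t) * ?q y + t * ?q x)"
      using convex_on_affine[of ?c "up_gf m w (Suc k) Q + ?c * ?q y" "?q x - ?q y"]
      by (simp add: algebra_simps)
    moreover have "filter ((<) x) (y # Q) = filter ((<) x) Q" using assms(1) by auto
    ultimately show ?thesis using 4 by (simp add: up_gf_shift_weight u)
  qed
qed

section \<open>Reduction to increasing lists\<close>

lemma not_sorted_adjacent_descent: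
  fixes L :: "'a::linorder list"
  assumes "\<not> sorted L"
  obtains P x y Q where "L = P @ x # y # Q" "y < x"
proof -
  obtain i where i: "Suc i < length L" "L ! Suc i < L ! i"
    using assms unfolding sorted_iff_nth_Suc by (auto simp: not_le)
  have "L = take i L @ L ! i # L ! Suc i # drop (Suc (Suc i)) L"
    using i(1) by (metis Cons_nth_drop_Suc Suc_lessD append_take_drop_id)
  then show ?thesis using that i(2) by blast
qed

text \<open>Each adjacent descent lets one letter be removed without changing the total weight, on
  which alone the bound \<open>B\<close> depends. As the weights change on the way, the hypothesis
  on sorted lists ranges over all \<open>w\<close>.\<close>

lemma up_gf_le_of_sorted:
  fixes B :: "real \<Rightarrow> real" and w :: "'a::linorder \<Rightarrow> real"
  assumes sorted: "\<And>w L. sorted_wrt (<) L \<Longrightarrow> (\<And>z::'a. 0 \<le> w z) \<Longrightarrow> up_gf m w k L \<le> B (\<Sum>z\<leftarrow>L. w z)"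
    and "distinct L" "\<And>z. 0 \<le> w z"
  shows "up_gf m w k L \<le> B (\<Sum>z\<leftarrow>L. w z)"
  using assms(2,3)
proof (induction L arbitrary: w rule: length_induct)
  case (1 L)
  show ?case
  proof (cases "sorted L")
    case True
    then show ?thesis using sorted[of L w] 1(2,3) by (simp add: strict_sorted_iff)
  next
    case False
    then obtain P x y Q where L: "L = P @ x # y # Q" and yx: "y < x"
      by (rule not_sorted_adjacent_descent)
    let ?c = "w x + w y" and ?u = "shift_weight w x y"
    have adj: "adjacent_in x y L"
      using 1(2) unfolding L adjacent_in_def by (intro exI[of _ P] exI[of _ "[x, y]"] exI[of _ Q]) auto
    have nn: "0 \<le> ?u t z" if "t \<in> {0..?c}" for t z
      using 1(3) that by (auto simp: shift_weight_def)
    have c: "0 \<in> {0..?c}" "?c \<in> {0..?c}" using 1(3) by auto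
    \<comment> \<open>Here \<open>v\<close> is the letter of weight zero at the endpoint
      \<open>t\<close>, and \<open>L'\<close> is \<open>L\<close> without \<open>v\<close>.\<close>
    have drop: "up_gf m (?u t) k L \<le> B (\<Sum>z\<leftarrow>L. w z)"
      if "t \<in> {0..?c}" "v \<in> {x, y}" "?u t v = 0" and L': "L' = P @ (if v = x then y else x) # Q" for t v L'
    proof -
      have "up_gf m (?u t) k L = up_gf m (?u t) k (filter (\<lambda>z. ?u t z \<noteq> 0) L)"
        by (rule up_gf_filter_support[symmetric])
      also have "filter (\<lambda>z. ?u t z \<noteq> 0) L = filter (\<lambda>z. ?u t z \<noteq> 0) L'"
        using that by (auto simp: L L')
      also have "up_gf m (?u t) k \<dots> = up_gf m (?u t) k L'"
        by (rule up_gf_filter_support)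
      also have "\<dots> \<le> B (\<Sum>z\<leftarrow>L'. ?u t z)"
      proof (rule "1.IH"[rule_format])
        show "length L' < length L" "distinct L'" using 1(2) that(2) by (auto simp: L L')
      qed (rule nn[OF that(1)])
      also have "(\<Sum>z\<leftarrow>L'. ?u t z) = (\<Sum>z\<leftarrow>L. ?u t z)"
        using that(2,3) by (auto simp: L L')
      also have "\<dots> = (\<Sum>z\<leftarrow>L. w z)"
      proof -
        have "map (?u t) P = map w P" "map (?u t) Q = map w Q"
          using 1(2) by (auto simp: L shift_weight_def)
        then show ?thesis
          using 1(2) by (simp add: L) (auto simp: shift_weight_def)
      qed
      finally show ?thesis .
    qed
    have "w = ?u (w x)" by (auto simp: shift_weight_def)
    then have "up_gf m w k L = up_gf m (?u (w x)) k L" by simp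
    \<comment> \<open>A convex function on an interval is at most its larger endpoint value;
      \<open>x\<close> has weight zero at \<open>0\<close> and \<open>y\<close> at
      \<open>?c\<close>.\<close>
    also have "\<dots> \<le> max (up_gf m (?u 0) k L) (up_gf m (?u ?c) k L)"
      by (rule convex_on_le_max[OF convex_up_gf[OF yx adj 1(3)]]) (use 1(3) in auto)
    also have "\<dots> \<le> B (\<Sum>z\<leftarrow>L. w z)"
      using drop[OF c(1) _ _ refl, of x] drop[OF c(2) _ _ refl, of y] yx
      by (auto simp: shift_weight_def)
    finally show ?thesis .
  qed
qed

section \<open>Elementary symmetric polynomials and the bound for increasing lists\<close>

fun esym :: "nat \<Rightarrow> real list \<Rightarrow> real" where
  "esym 0 ws = 1"
| "esym (Suc k) [] = 0"
| "esym (Suc k) (a # ws) = esym (Suc k) ws + a * esym k ws"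

lemma esym_snoc: "esym (Suc k) (ws @ [a]) = esym (Suc k) ws + a * esym k ws"
proof (induction "Suc k" ws arbitrary: k rule: esym.induct)
  case (2 k)
  then show ?case by (cases k) auto
next
  case (3 k a' ws)
  then show ?case by (cases k) (auto simp: algebra_simps)
qed

lemma power_Suc_add_ge:
  fixes s a :: real
  assumes "0 \<le> s" "0 \<le> a"
  shows "s ^ Suc n + real (Suc n) * a * s ^ n \<le> (s + a) ^ Suc n"
  using power_diff_ge[of s "s + a" n] assms by (simp add: algebra_simps)

text \<open>The left side is the part of the expanded power coming from words that use
  \<open>k\<close> different positions of \<open>ws\<close>.\<close>

lemma fact_esym_le:
  assumes "\<And>a. a \<in> set ws \<Longrightarrow> 0 \<le> a"
  shows "fact k * esym k ws \<le> sum_list ws ^ k"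
  using assms
proof (induction ws arbitrary: k rule: rev_induct)
  case Nil
  then show ?case by (cases k) auto
next
  case (snoc a ws)
  show ?case
  proof (cases k)
    case (Suc n)
    have s: "0 \<le> sum_list ws" using snoc.prems by (intro sum_list_nonneg) auto
    have "fact k * esym k (ws @ [a]) = fact (Suc n) * esym (Suc n) ws + real (Suc n) * a * (fact n * esym n ws)"
      unfolding Suc esym_snoc by (simp add: algebra_simps)
    also have "\<dots> \<le> sum_list ws ^ Suc n + real (Suc n) * a * sum_list ws ^ n"
      using snoc by (intro add_mono mult_left_mono) (auto simp del: fact_Suc power_Suc)
    also have "\<dots> \<le> (sum_list ws + a) ^ Suc n"
      using snoc.prems s by (intro power_Suc_add_ge) auto
    finally show ?thesis by (simp add: Suc)
  qed simp
qed

text \<open>The words with all letters equal are not counted by \<open>fact k * esym k\<close> once \<open>k \<ge> 2\<close>.\<close>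

lemma fact_esym_add_sum_powers_le:
  assumes "\<And>a. a \<in> set ws \<Longrightarrow> 0 \<le> a"
  shows "fact (Suc (Suc n)) * esym (Suc (Suc n)) ws + (\<Sum>a\<leftarrow>ws. a ^ Suc (Suc n)) \<le> sum_list ws ^ Suc (Suc n)"
  using assms
proof (induction ws rule: rev_induct)
  case (snoc a ws)
  let ?s = "sum_list ws" and ?k = "Suc (Suc n)"
  have s: "0 \<le> ?s" and a: "0 \<le> a" using snoc.prems by (auto intro: sum_list_nonneg)
  have "fact ?k * esym ?k (ws @ [a]) + (\<Sum>a\<leftarrow>ws @ [a]. a ^ ?k)
      = (fact ?k * esym ?k ws + (\<Sum>a\<leftarrow>ws. a ^ ?k)) + real ?k * a * (fact (Suc n) * esym (Suc n) ws) + a ^ ?k"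
    unfolding esym_snoc by (simp add: algebra_simps)
  also have "\<dots> \<le> ?s ^ ?k + real ?k * a * ?s ^ Suc n + a ^ ?k"
    using snoc a by (intro add_mono mult_left_mono fact_esym_le) auto
  also have "\<dots> \<le> (?s + a) ^ ?k"
  proof -
    \<comment> \<open>One of the \<open>?k\<close> copies of \<open>a * ?s ^ Suc n\<close> is moved
      to the second bracket, so that each bracket is at most
      \<open>(?s + a) ^ Suc n\<close>.\<close>
    have "?s ^ ?k + real ?k * a * ?s ^ Suc n + a ^ ?k
        = ?s * (?s ^ Suc n + real (Suc n) * a * ?s ^ n) + a * (?s ^ Suc n + a ^ Suc n)"
      by (simp add: algebra_simps)
    also have "\<dots> \<le> ?s * (?s + a) ^ Suc n + a * (?s + a) ^ Suc n"
    proof (intro add_mono mult_left_mono s a power_Suc_add_ge)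
      have "?s ^ Suc n + a ^ Suc n \<le> ?s * (?s + a) ^ n + a * (?s + a) ^ n"
        using s a by (auto intro!: add_mono mult_left_mono power_mono)
      then show "?s ^ Suc n + a ^ Suc n \<le> (?s + a) ^ Suc n" by (simp add: algebra_simps)
    qed
    finally show ?thesis by (simp add: algebra_simps)
  qed
  finally show ?case by simp
qed simp

text \<open>In an increasing list a decreasing subsequence has at most one letter, so a nonempty
  word repeats a single letter.\<close>

lemma desc_gf_sorted:
  assumes "sorted_wrt (<) L"
  shows "fps_nth (desc_gf w L) (Suc n) = (\<Sum>z\<leftarrow>L. w z ^ Suc n) / fact (Suc n)"
  using assms
proof (induction L)
  case (Cons z L)
  then have "filter (\<lambda>y. y < z) L = []"
    by (auto simp: filter_empty_conv dest: less_asym)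
  then show ?case using Cons by (simp add: add_divide_distrib del: fact_Suc)
qed simp

text \<open>The last and largest letter cannot be an increasing one, since \<open>Suc n\<close>
  letters would still have to follow. If used, it forms the whole decreasing part, after
  \<open>k\<close> increasing letters of \<open>L\<close>.\<close>

lemma up_gf_sorted_snoc:
  assumes "sorted_wrt (<) (L @ [x])"
  shows "up_gf (Suc n) w k (L @ [x]) = up_gf (Suc n) w k L + esym k (map w L) * w x ^ Suc n / fact (Suc n)"
  using assms
proof (induction L arbitrary: k)
  case Nil
  have "up_gf (Suc n) w j [] = 0" for j by (cases j) auto
  then show ?case by (cases k) (auto simp del: fact_Suc)
next
  case (Cons z L)
  show ?case
  proof (cases k)
    case 0
    have "sorted_wrt (<) (z # L)" using Cons.prems by (auto simp: sorted_wrt_append)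
    then show ?thesis
      using desc_gf_sorted[OF Cons.prems] desc_gf_sorted[of "z # L"] 0
      by (simp only: up_gf.simps esym.simps append_Cons) (simp add: add_divide_distrib)
  next
    case (Suc j)
    have "filter ((<) z) (L @ [x]) = L @ [x]" "filter ((<) z) L = L"
      using Cons.prems by (auto simp: filter_id_conv)
    then show ?thesis using Cons Suc by (simp add: algebra_simps add_divide_distrib)
  qed
qed

text \<open>A letter of weight \<open>a\<close> preceded by total weight \<open>s\<close>
  contributes at most \<open>(s * a) ^ Suc n\<close>. Replacing \<open>s\<close> by the cutoff
  \<open>x\<close> costs at most \<open>Suc n * (Q\<^sup>2 / 4) ^ n * a * max 0 (s - x)\<close>, as
  \<open>4 * s * a\<close> is at most \<open>Q\<^sup>2\<close>. The costs add up to a lower Riemann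
  sum of \<open>max 0 (t - x)\<close>, whence the square over 2. \<open>Q\<close> stays fixed while
  the list grows.\<close>

lemma up_gf_sorted_le_truncated:
  fixes w :: "'a::linorder \<Rightarrow> real" and Q x :: real
  assumes "sorted_wrt (<) L" "\<And>z. 0 \<le> w z" "(\<Sum>z\<leftarrow>L. w z) \<le> Q" "0 \<le> x"
  shows "fact (Suc n) ^ 2 * up_gf (Suc n) w (Suc n) L \<le>
     x ^ Suc n * (\<Sum>z\<leftarrow>L. w z ^ Suc n)
     + real (Suc n) * (Q\<^sup>2 / 4) ^ n * ((max 0 ((\<Sum>z\<leftarrow>L. w z) - x))\<^sup>2 / 2)"
  using assms
proof (induction L rule: rev_induct)
  case (snoc y L)
  let ?s = "\<Sum>z\<leftarrow>L. w z" and ?m = "Suc n" and ?a = "w y"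
  let ?p = "max 0 (?s - x)"
  have a: "0 \<le> ?a" and s: "0 \<le> ?s" using snoc.prems by (auto intro!: sum_list_nonneg)
  have sq: "?s + ?a \<le> Q" using snoc.prems(3) by simp
  then have sQ: "?s \<le> Q" using a by linarith
  have IH: "fact ?m ^ 2 * up_gf ?m w ?m L \<le> x ^ ?m * (\<Sum>z\<leftarrow>L. w z ^ ?m)
     + real ?m * (Q\<^sup>2 / 4) ^ n * (?p\<^sup>2 / 2)"
    by (rule snoc.IH) (use snoc.prems sQ in \<open>auto simp: sorted_wrt_append\<close>)
  have "(?s * ?a) ^ ?m \<le> (x * ?a) ^ ?m + real ?m * (Q\<^sup>2 / 4) ^ n * (?a * ?p)"
  proof (cases "?s \<le> x")
    case True
    then have "(?s * ?a) ^ ?m \<le> (x * ?a) ^ ?m"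
      using a s by (intro power_mono mult_right_mono) auto
    then show ?thesis using True by simp
  next
    case False
    have "(?s * ?a) ^ ?m - (x * ?a) ^ ?m \<le> real ?m * (?s * ?a) ^ n * (?s * ?a - x * ?a)"
      using False a s snoc.prems(4) by (intro power_diff_le) (auto intro!: mult_right_mono)
    also have "\<dots> = real ?m * (?s * ?a) ^ n * (?a * ?p)"
      using False by (simp add: algebra_simps)
    also have "\<dots> \<le> real ?m * (Q\<^sup>2 / 4) ^ n * (?a * ?p)"
    proof (intro mult_right_mono mult_left_mono power_mono)
      have "4 * (?s * ?a) \<le> (?s + ?a)\<^sup>2"
        using zero_le_power2[of "?s - ?a"] by (simp add: power2_eq_square algebra_simps)
      also have "\<dots> \<le> Q\<^sup>2" using a s sq by (intro power_mono) auto
      finally show "?s * ?a \<le> Q\<^sup>2 / 4" by simp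
    qed (use a s in auto)
    finally show ?thesis by simp
  qed
  moreover have "fact ?m ^ 2 * up_gf ?m w ?m (L @ [y]) =
      fact ?m ^ 2 * up_gf ?m w ?m L + (fact ?m * esym ?m (map w L)) * ?a ^ ?m"
    using snoc.prems(1) by (simp add: up_gf_sorted_snoc power2_eq_square algebra_simps del: fact_Suc)
  moreover have "(fact ?m * esym ?m (map w L)) * ?a ^ ?m \<le> (?s * ?a) ^ ?m"
    unfolding power_mult_distrib using snoc.prems(2) by (intro mult_right_mono fact_esym_le) auto
  ultimately have "fact ?m ^ 2 * up_gf ?m w ?m (L @ [y]) \<le> x ^ ?m * (\<Sum>z\<leftarrow>L. w z ^ ?m) + (x * ?a) ^ ?m
      + real ?m * (Q\<^sup>2 / 4) ^ n * (?p\<^sup>2 / 2 + ?a * ?p)"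
    using IH unfolding distrib_left by linarith
  \<comment> \<open>One rectangle of the Riemann sum: width \<open>?a\<close>, height the value of
    \<open>max 0 (t - x)\<close> at the left end \<open>?s\<close>.\<close>
  moreover have "?p\<^sup>2 / 2 + ?a * ?p \<le> (max 0 (?s + ?a - x))\<^sup>2 / 2"
  proof (cases "?s \<le> x")
    case True
    then have "?p = 0" by simp
    then show ?thesis by simp
  next
    case False
    have "(?s - x)\<^sup>2 + 2 * ?a * (?s - x) + ?a\<^sup>2 = (?s + ?a - x)\<^sup>2"
      by (simp add: power2_eq_square algebra_simps)
    then have "(?s - x)\<^sup>2 / 2 + ?a * (?s - x) \<le> (?s + ?a - x)\<^sup>2 / 2"
      using zero_le_power2[of ?a] by linarith
    then show ?thesis using False a by (simp add: max_def)
  qed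
  then have "real ?m * (Q\<^sup>2 / 4) ^ n * (?p\<^sup>2 / 2 + ?a * ?p)
      \<le> real ?m * (Q\<^sup>2 / 4) ^ n * ((max 0 (?s + ?a - x))\<^sup>2 / 2)"
    by (intro mult_left_mono) auto
  ultimately have "fact ?m ^ 2 * up_gf ?m w ?m (L @ [y]) \<le> x ^ ?m * (\<Sum>z\<leftarrow>L. w z ^ ?m) + (x * ?a) ^ ?m
      + real ?m * (Q\<^sup>2 / 4) ^ n * ((max 0 (?s + ?a - x))\<^sup>2 / 2)" by linarith
  then show ?case
    by (simp add: distrib_left power_mult_distrib del: fact_Suc power_Suc)
qed simp

text \<open>For \<open>2 * ?x\<close> at most \<open>?s\<close>, the induction hypothesis and
  \<open>fact_esym_le\<close> suffice. Otherwise the truncated bound with cutoff \<open>?x\<close>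
  is used, and its error is absorbed by the gap \<open>(?s - ?x)\<^sup>2 / 4\<close> between
  \<open>(?s + ?x)\<^sup>2 / 4\<close> and \<open>?s * ?x\<close>.\<close>

lemma up_gf_sorted_le:
  fixes w :: "'a::linorder \<Rightarrow> real"
  assumes "sorted_wrt (<) L" "\<And>z. 0 \<le> w z"
  shows "fact (Suc (Suc n)) ^ 2 * up_gf (Suc (Suc n)) w (Suc (Suc n)) L \<le> ((\<Sum>z\<leftarrow>L. w z)\<^sup>2 / 4) ^ Suc (Suc n)"
  using assms
proof (induction L rule: rev_induct)
  case (snoc y L)
  let ?s = "\<Sum>z\<leftarrow>L. w z" and ?m = "Suc (Suc n)" and ?x = "w y"
  have x: "0 \<le> ?x" and s: "0 \<le> ?s" using snoc.prems by (auto intro!: sum_list_nonneg)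
  have sorted: "sorted_wrt (<) L" using snoc.prems by (simp add: sorted_wrt_append)
  have eq: "fact ?m ^ 2 * up_gf ?m w ?m (L @ [y]) =
      fact ?m ^ 2 * up_gf ?m w ?m L + (fact ?m * esym ?m (map w L)) * ?x ^ ?m"
    using snoc.prems(1) by (simp add: up_gf_sorted_snoc power2_eq_square algebra_simps del: fact_Suc)
  have "fact ?m ^ 2 * up_gf ?m w ?m (L @ [y]) \<le> ((?s + ?x)\<^sup>2 / 4) ^ ?m"
  proof (cases "2 * ?x \<le> ?s")
    case True
    let ?p = "(?s + ?x)\<^sup>2" and ?q = "4 * ?s * ?x" and ?r = "?s\<^sup>2"
    have "fact ?m ^ 2 * up_gf ?m w ?m (L @ [y]) \<le> (?s\<^sup>2 / 4) ^ ?m + ?s ^ ?m * ?x ^ ?m"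
      unfolding eq using snoc sorted x by (intro add_mono mult_right_mono fact_esym_le) auto
    also have "\<dots> = (?r ^ ?m + ?q ^ ?m) / 4 ^ ?m"
      by (simp add: power_divide power_mult_distrib field_simps)
    also have "?r ^ ?m + ?q ^ ?m \<le> ?p ^ ?m"
    proof -
      have "0 \<le> (?s - ?x)\<^sup>2" by simp
      then have q: "?q \<le> ?p" by (simp add: power2_eq_square algebra_simps)
      have r: "?r \<le> ?p" using s x by (intro power_mono) auto
      \<comment> \<open>Exponent 2 is enough, because \<open>?q\<close> and \<open>?r\<close> are at
        most \<open>?p\<close>. The factor \<open>?s - 2 * ?x\<close> in the cubic below explains
        the threshold of the case split.\<close>
      have "?p\<^sup>2 - ?q\<^sup>2 - ?r\<^sup>2 = ?x * (4 * ?s ^ 3 - 10 * ?s\<^sup>2 * ?x + 4 * ?s * ?x\<^sup>2 + ?x ^ 3)"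
        by (simp add: power2_eq_square power3_eq_cube algebra_simps)
      also have "4 * ?s ^ 3 - 10 * ?s\<^sup>2 * ?x + 4 * ?s * ?x\<^sup>2 + ?x ^ 3
          = 2 * ?s * ((?s - 2 * ?x) * (2 * ?s - ?x)) + ?x ^ 3"
        by (simp add: power2_eq_square power3_eq_cube algebra_simps)
      also have "0 \<le> ?x * (2 * ?s * ((?s - 2 * ?x) * (2 * ?s - ?x)) + ?x ^ 3)"
        using True s x by (intro mult_nonneg_nonneg add_nonneg_nonneg) auto
      finally have "?r\<^sup>2 + ?q\<^sup>2 \<le> ?p\<^sup>2" by linarith
      have "?r ^ ?m + ?q ^ ?m = ?r ^ n * ?r\<^sup>2 + ?q ^ n * ?q\<^sup>2"
        by (simp only: power_add[symmetric] add_2_eq_Suc')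
      also have "\<dots> \<le> ?p ^ n * ?r\<^sup>2 + ?p ^ n * ?q\<^sup>2"
        using q r s x by (intro add_mono mult_right_mono power_mono) auto
      also have "\<dots> = ?p ^ n * (?r\<^sup>2 + ?q\<^sup>2)" by (simp add: algebra_simps)
      also have "\<dots> \<le> ?p ^ n * ?p\<^sup>2"
        using \<open>?r\<^sup>2 + ?q\<^sup>2 \<le> ?p\<^sup>2\<close> by (intro mult_left_mono) auto
      also have "\<dots> = ?p ^ ?m" by (simp only: power_add[symmetric] add_2_eq_Suc')
      finally show ?thesis .
    qed
    finally show ?thesis by (simp add: power_divide divide_right_mono)
  next
    case False
    let ?S = "\<Sum>z\<leftarrow>L. w z ^ ?m"
    have e: "fact ?m * esym ?m (map w L) \<le> ?s ^ ?m - ?S"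
    proof -
      have "fact ?m * esym ?m (map w L) + (\<Sum>a\<leftarrow>map w L. a ^ ?m) \<le> ?s ^ ?m"
        using snoc.prems(2) by (intro fact_esym_add_sum_powers_le) auto
      then show ?thesis by (simp add: o_def del: fact_Suc power_Suc)
    qed
    \<comment> \<open>The term \<open>?x ^ ?m * ?S\<close> of the truncated bound cancels against
      the words with all letters equal that are missing in \<open>esym\<close>.\<close>
    have "fact ?m ^ 2 * up_gf ?m w ?m (L @ [y]) \<le>
        ?x ^ ?m * ?S + real ?m * (?s\<^sup>2 / 4) ^ Suc n * ((max 0 (?s - ?x))\<^sup>2 / 2) + (?s ^ ?m - ?S) * ?x ^ ?m"
      unfolding eq using x by (intro add_mono mult_right_mono e up_gf_sorted_le_truncated sorted snoc.prems(2)) auto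
    also have "\<dots> = (?s * ?x) ^ ?m + real ?m * (?s\<^sup>2 / 4) ^ Suc n * ((max 0 (?s - ?x))\<^sup>2 / 2)"
      by (simp add: algebra_simps power_mult_distrib)
    also have "\<dots> \<le> (?s * ?x) ^ ?m + real ?m * (?s * ?x) ^ Suc n * ((?s - ?x)\<^sup>2 / 4)"
    proof -
      \<comment> \<open>The extra factor 2 turns the denominator 2 of the error into the 4 of the
        gap. It is paid for by \<open>2 ^ Suc n\<close>, as \<open>?s < 2 * ?x\<close> gives
        \<open>?s\<^sup>2 / 2 \<le> ?s * ?x\<close>.\<close>
      have "2 * (?s\<^sup>2 / 4) ^ Suc n \<le> 2 ^ Suc n * (?s\<^sup>2 / 4) ^ Suc n"
        by (intro mult_right_mono) auto
      also have "\<dots> = (?s\<^sup>2 / 2) ^ Suc n"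
        unfolding power_mult_distrib[symmetric] by simp
      also have "\<dots> \<le> (?s * ?x) ^ Suc n"
        using False s mult_left_mono[of ?s "2 * ?x" ?s] by (intro power_mono) (auto simp: power2_eq_square)
      finally have *: "2 * (?s\<^sup>2 / 4) ^ Suc n \<le> (?s * ?x) ^ Suc n" .
      have "(max 0 (?s - ?x))\<^sup>2 \<le> (?s - ?x)\<^sup>2" by (auto simp: max_def)
      then have "real ?m * (?s\<^sup>2 / 4) ^ Suc n * ((max 0 (?s - ?x))\<^sup>2 / 2)
          \<le> real ?m * (?s\<^sup>2 / 4) ^ Suc n * ((?s - ?x)\<^sup>2 / 2)"
        by (intro mult_left_mono) auto
      also have "\<dots> = real ?m * (2 * (?s\<^sup>2 / 4) ^ Suc n) * ((?s - ?x)\<^sup>2 / 4)"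
        by (simp add: algebra_simps)
      also have "\<dots> \<le> real ?m * (?s * ?x) ^ Suc n * ((?s - ?x)\<^sup>2 / 4)"
        by (intro mult_right_mono mult_left_mono *) auto
      finally show ?thesis by simp
    qed
    also have "\<dots> \<le> ((?s + ?x)\<^sup>2 / 4) ^ ?m"
    proof -
      have d: "(?s + ?x)\<^sup>2 / 4 - ?s * ?x = (?s - ?x)\<^sup>2 / 4"
        by (simp add: power2_eq_square field_simps)
      have "?s * ?x \<le> (?s + ?x)\<^sup>2 / 4" using d zero_le_power2[of "?s - ?x"] by linarith
      with s x have "real ?m * (?s * ?x) ^ Suc n * ((?s - ?x)\<^sup>2 / 4) \<le> ((?s + ?x)\<^sup>2 / 4) ^ ?m - (?s * ?x) ^ ?m"
        unfolding d[symmetric] by (intro power_diff_ge mult_nonneg_nonneg)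
      then show ?thesis by linarith
    qed
    finally show ?thesis .
  qed
  then show ?case by simp
qed simp

lemma up_gf_le:
  fixes w :: "'a::linorder \<Rightarrow> real"
  assumes "2 \<le> m" "distinct L" "\<And>z. 0 \<le> w z"
  shows "up_gf m w m L \<le> ((\<Sum>z\<leftarrow>L. w z)\<^sup>2 / 4) ^ m / fact m ^ 2"
proof -
  obtain n where m: "m = Suc (Suc n)" using assms(1) by (metis add_2_eq_Suc le_Suc_ex)
  show ?thesis
  proof (rule up_gf_le_of_sorted[where B = "\<lambda>s. (s\<^sup>2 / 4) ^ m / fact m ^ 2"])
    fix w :: "'a \<Rightarrow> real" and L :: "'a list" assume "sorted_wrt (<) L" "\<And>z::'a. 0 \<le> w z"
    then show "up_gf m w m L \<le> ((\<Sum>z\<leftarrow>L. w z)\<^sup>2 / 4) ^ m / fact m ^ 2"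
      using up_gf_sorted_le[of L w n] by (simp add: m field_simps del: fact_Suc)
  qed (use assms in auto)
qed

section \<open>Occurrences as subsequences of the one-line notation\<close>

fun up_down :: "nat \<Rightarrow> nat \<Rightarrow> 'a::linorder list \<Rightarrow> bool" where
  "up_down m 0 ys \<longleftrightarrow> length ys = m \<and> sorted_wrt (>) ys"
| "up_down m (Suc k) [] \<longleftrightarrow> False"
| "up_down m (Suc k) (z # ys) \<longleftrightarrow> (\<forall>y\<in>set ys. z < y) \<and> up_down m k ys"

lemma up_downI:
  assumes "length ys = k + m"
    and "\<And>i j. i < k \<Longrightarrow> i < j \<Longrightarrow> j < length ys \<Longrightarrow> ys ! i < ys ! j"
    and "\<And>i j. k \<le> i \<Longrightarrow> i < j \<Longrightarrow> j < length ys \<Longrightarrow> ys ! j < ys ! i"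
  shows "up_down m k ys"
  using assms
proof (induction m k ys rule: up_down.induct)
  case (1 m ys)
  then show ?case by (auto simp: sorted_wrt_iff_nth_less)
next
  case (3 m k z ys)
  have "z < y" if "y \<in> set ys" for y
    using that 3(3)[of 0 "Suc j" for j] by (auto simp: in_set_conv_nth)
  moreover have "up_down m k ys"
  proof (rule 3(1))
    show "length ys = k + m" using 3(2) by simp
    show "ys ! i < ys ! j" if "i < k" "i < j" "j < length ys" for i j
      using 3(3)[of "Suc i" "Suc j"] that by simp
    show "ys ! j < ys ! i" if "k \<le> i" "i < j" "j < length ys" for i j
      using 3(4)[of "Suc i" "Suc j"] that by simp
  qed
  ultimately show ?case by simp
qed simp

lemma finite_subseqs: "finite {ys. subseq ys L \<and> P ys}"
  by (rule finite_subset[of _ "set (subseqs L)"]) auto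

lemma subseq_Cons_split:
  assumes "subseq ys (z # L)" "\<not> subseq ys L"
  obtains ys' where "ys = z # ys'" "subseq ys' L"
proof (cases ys)
  case (Cons y ys')
  then show ?thesis using assms that by (cases "y = z") auto
qed (use assms in auto)

lemma subseq_filter_all: "subseq ys L \<Longrightarrow> (\<And>y. y \<in> set ys \<Longrightarrow> P y) \<Longrightarrow> subseq ys (filter P L)"
  using subseq_filter[of ys L P] by (simp add: filter_id_conv[THEN iffD2])

text \<open>A subsequence uses each chosen letter once, which is the linear term of
  \<open>fps_exp 1 - 1\<close>. The higher terms, for repeated letters, only enlarge the
  coefficient.\<close>

lemma card_desc_subseqs_le:
  "real (card {ys. subseq ys L \<and> length ys = k \<and> sorted_wrt (>) ys}) \<le> fps_nth (desc_gf (\<lambda>_. 1) L) k"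
proof (induction "\<lambda>_::'a. 1 :: real" L arbitrary: k rule: desc_gf.induct)
  case 1
  have "{ys. subseq ys [] \<and> length ys = k \<and> sorted_wrt (>) ys} = (if k = 0 then {[] :: 'a list} else {})"
    by auto
  then show ?case by simp
next
  case (2 z L)
  let ?D = "desc_gf (\<lambda>_. 1 :: real)" and ?F = "filter (\<lambda>y. y < z) L"
  let ?S = "\<lambda>L k. {ys. subseq ys L \<and> length ys = k \<and> sorted_wrt (>) ys}"
  have nn: "0 \<le> fps_nth (?D L') i" for L' :: "'a list" and i by (rule desc_gf_nonneg) simp
  show ?case
  proof (cases k)
    case 0
    have "?S (z # L) 0 = ?S L 0" by auto
    then show ?thesis using 2(1)[of 0] 0 by simp
  next
    case (Suc j)
    have "?S (z # L) (Suc j) \<subseteq> ?S L (Suc j) \<union> (#) z ` ?S ?F j"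
    proof
      fix ys assume ys: "ys \<in> ?S (z # L) (Suc j)"
      show "ys \<in> ?S L (Suc j) \<union> (#) z ` ?S ?F j"
      proof (cases "subseq ys L")
        case False
        have "subseq ys (z # L)" using ys by simp
        then obtain ys' where "ys = z # ys'" "subseq ys' L"
          using False by (rule subseq_Cons_split)
        then show ?thesis using ys by (auto intro: subseq_filter_all)
      qed (use ys in auto)
    qed
    then have "card (?S (z # L) (Suc j)) \<le> card (?S L (Suc j) \<union> (#) z ` ?S ?F j)"
      by (rule card_mono[rotated]) (intro finite_UnI finite_imageI finite_subseqs)
    also have "\<dots> \<le> card (?S L (Suc j)) + card (?S ?F j)"
      by (intro order.trans[OF card_Un_le] add_left_mono card_image_le finite_subseqs)
    finally have "real (card (?S (z # L) (Suc j))) \<le> fps_nth (?D L) (Suc j) + fps_nth (?D ?F) j"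
      using 2(1)[of "Suc j"] 2(2)[of j] by linarith
    also have "fps_nth (?D ?F) j \<le> fps_nth ((fps_exp 1 - 1) * ?D ?F) (Suc j)"
    proof -
      \<comment> \<open>Only the summand with index 1 of the Cauchy product is kept; its first
        factor equals 1.\<close>
      have "fps_nth (fps_exp 1 - 1 :: real fps) 1 * fps_nth (?D ?F) (Suc j - 1)
          \<le> fps_nth ((fps_exp 1 - 1) * ?D ?F) (Suc j)"
        unfolding fps_mult_nth
        by (rule member_le_sum[of 1 _ "\<lambda>i. fps_nth (fps_exp 1 - 1 :: real fps) i * fps_nth (?D ?F) (Suc j - i)"])
          (auto intro!: mult_nonneg_nonneg nn fps_exp_minus_one_nonneg simp del: fps_sub_nth)
      then show ?thesis by simp
    qed
    finally show ?thesis by (simp add: Suc)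
  qed
qed

lemma card_up_down_subseqs_le:
  "real (card {ys. subseq ys L \<and> up_down m k ys}) \<le> up_gf m (\<lambda>_. 1) k L"
proof (induction m "\<lambda>_::'a. 1 :: real" k L rule: up_gf.induct)
  case (1 m L)
  then show ?case using card_desc_subseqs_le[of L m] by simp
next
  case (2 m k)
  have "{ys :: 'a list. subseq ys [] \<and> up_down m (Suc k) ys} = {}"
    by (auto dest: list_emb_Nil2)
  then show ?case by (simp only: card.empty up_gf.simps)
next
  case (3 m k z L)
  let ?S = "\<lambda>L k. {ys. subseq ys L \<and> up_down m k ys}" and ?F = "filter ((<) z) L"
  have "?S (z # L) (Suc k) \<subseteq> ?S L (Suc k) \<union> (#) z ` ?S ?F k"
  proof
    fix ys assume ys: "ys \<in> ?S (z # L) (Suc k)"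
    show "ys \<in> ?S L (Suc k) \<union> (#) z ` ?S ?F k"
    proof (cases "subseq ys L")
      case False
      have "subseq ys (z # L)" using ys by simp
      then obtain ys' where "ys = z # ys'" "subseq ys' L"
        using False by (rule subseq_Cons_split)
      then show ?thesis using ys by (auto intro: subseq_filter_all)
    qed (use ys in auto)
  qed
  then have "card (?S (z # L) (Suc k)) \<le> card (?S L (Suc k) \<union> (#) z ` ?S ?F k)"
    by (rule card_mono[rotated]) (intro finite_UnI finite_imageI finite_subseqs)
  also have "\<dots> \<le> card (?S L (Suc k)) + card (?S ?F k)"
    by (intro order.trans[OF card_Un_le] add_left_mono card_image_le finite_subseqs)
  finally show ?case using 3 by simp
qed

lemma tau_diag_eq:
  assumes "i \<in> {1..2 * \<alpha>}"
  shows "tau_diag \<alpha> i = (if i \<le> \<alpha> then i else 3 * \<alpha> + 1 - i)"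
proof (cases "i \<le> \<alpha>")
  case True
  then have "([1..<\<alpha> + 1] @ rev [\<alpha> + 1..<2 * \<alpha> + 1]) ! (i - 1) = [1..<\<alpha> + 1] ! (i - 1)"
    using assms by (subst nth_append_left) auto
  then show ?thesis using True assms by (simp add: tau_diag_def one_line_def nth_upt del: upt_Suc)
next
  case False
  then have "([1..<\<alpha> + 1] @ rev [\<alpha> + 1..<2 * \<alpha> + 1]) ! (i - 1) = rev [\<alpha> + 1..<2 * \<alpha> + 1] ! (i - 1 - \<alpha>)"
    using assms by (subst nth_append_right) auto
  also have "\<dots> = [\<alpha> + 1..<2 * \<alpha> + 1] ! (\<alpha> - Suc (i - 1 - \<alpha>))"
    using False assms by (subst rev_nth) auto
  also have "\<dots> = 3 * \<alpha> + 1 - i"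
    using False assms by (subst nth_upt) auto
  finally show ?thesis using False assms by (simp add: tau_diag_def one_line_def del: upt_Suc)
qed

text \<open>First-half entries increase and lie below all second-half entries, which decrease. Hence
  the half containing the earlier position decides, and both bounds use the pattern only in this
  form.\<close>

lemma tau_diag_less_iff:
  assumes "1 \<le> i" "i < j" "j \<le> 2 * \<alpha>"
  shows "tau_diag \<alpha> i < tau_diag \<alpha> j \<longleftrightarrow> i \<le> \<alpha>" "tau_diag \<alpha> j < tau_diag \<alpha> i \<longleftrightarrow> \<alpha> < i"
proof -
  have "tau_diag \<alpha> i = (if i \<le> \<alpha> then i else 3 * \<alpha> + 1 - i)" "tau_diag \<alpha> j = (if j \<le> \<alpha> then j else 3 * \<alpha> + 1 - j)"
    using assms by (simp_all add: tau_diag_eq)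
  then show "tau_diag \<alpha> i < tau_diag \<alpha> j \<longleftrightarrow> i \<le> \<alpha>" "tau_diag \<alpha> j < tau_diag \<alpha> i \<longleftrightarrow> \<alpha> < i"
    using assms by auto
qed

text \<open>An occurrence is sent to its word of values read from left to right; injectivity of
  \<open>\<sigma>\<close> recovers the positions.\<close>

lemma num_occ_tau_diag_le:
  assumes "\<sigma> permutes {1..n}"
  shows "real (num_occ (2 * \<alpha>) (tau_diag \<alpha>) n \<sigma>) \<le> up_gf \<alpha> (\<lambda>_. 1) \<alpha> (map \<sigma> [1..<Suc n])"
proof -
  let ?O = "occurrences (2 * \<alpha>) (tau_diag \<alpha>) n \<sigma>" and ?L = "map \<sigma> [1..<Suc n]"
  let ?w = "\<lambda>S. map \<sigma> (sorted_list_of_set S)"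
  have inj: "inj \<sigma>" using assms by (rule permutes_inj)
  have "inj_on ?w ?O"
  proof (rule inj_onI)
    fix S T assume "S \<in> ?O" "T \<in> ?O" and eq: "?w S = ?w T"
    then have "finite S" "finite T" by (auto simp: occurrences_def intro: finite_subset[OF _ finite_atLeastAtMost])
    moreover have "sorted_list_of_set S = sorted_list_of_set T"
      using eq inj by (simp add: inj_map_eq_map)
    ultimately show "S = T" by (metis sorted_list_of_set.set_sorted_key_list_of_set)
  qed
  moreover have "?w ` ?O \<subseteq> {ys. subseq ys ?L \<and> up_down \<alpha> \<alpha> ys}"
  proof (intro image_subsetI CollectI conjI)
    fix S assume S: "S \<in> ?O"
    then have sub: "S \<subseteq> {1..n}" and "order_iso_restr (2 * \<alpha>) (tau_diag \<alpha>) \<sigma> S"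
      by (auto simp: occurrences_def)
    then obtain f where f: "strict_mono_on {1..2 * \<alpha>} f" "f ` {1..2 * \<alpha>} = S"
      "\<And>i j. i \<in> {1..2 * \<alpha>} \<Longrightarrow> j \<in> {1..2 * \<alpha>} \<Longrightarrow> \<sigma> (f i) < \<sigma> (f j) \<longleftrightarrow> tau_diag \<alpha> i < tau_diag \<alpha> j"
      unfolding order_iso_restr_def by blast
    have fin: "finite S" using sub finite_subset by blast
    have "sorted_list_of_set S = filter (\<lambda>i. i \<in> S) [1..<Suc n]"
      using sub fin by (intro strict_sorted_equal sorted_wrt_filter) (auto simp del: upt_Suc)
    then show "subseq (?w S) ?L" by (simp add: subseq_map del: upt_Suc)
    let ?f = "map f [1..<Suc (2 * \<alpha>)]"
    have "sorted_wrt (<) ?f"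
      unfolding sorted_wrt_map
      by (rule sorted_wrt_mono_rel[OF _ sorted_wrt_upt])
        (auto simp del: upt_Suc intro!: strict_mono_onD[OF f(1)])
    then have "sorted_list_of_set S = ?f"
      using fin f(2) by (intro strict_sorted_equal) (auto simp: atLeastLessThanSuc_atLeastAtMost simp del: upt_Suc)
    then have w: "?w S = map (\<sigma> \<circ> f) [1..<Suc (2 * \<alpha>)]" by (simp del: upt_Suc)
    show "up_down \<alpha> \<alpha> (?w S)"
      unfolding w
    proof (rule up_downI)
      fix i j assume ij: "i < j" "j < length (map (\<sigma> \<circ> f) [1..<Suc (2 * \<alpha>)])"
      \<comment> \<open>List indices start at 0 and the arguments of \<open>f\<close> at 1, hence
        the shift by \<open>Suc\<close>.\<close>
      then have *: "map (\<sigma> \<circ> f) [1..<Suc (2 * \<alpha>)] ! i = \<sigma> (f (Suc i))"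
        "map (\<sigma> \<circ> f) [1..<Suc (2 * \<alpha>)] ! j = \<sigma> (f (Suc j))"
        by (simp_all del: upt_Suc)
      have mem: "Suc i \<in> {1..2 * \<alpha>}" "Suc j \<in> {1..2 * \<alpha>}" using ij by (auto simp del: upt_Suc)
      show "map (\<sigma> \<circ> f) [1..<Suc (2 * \<alpha>)] ! i < map (\<sigma> \<circ> f) [1..<Suc (2 * \<alpha>)] ! j" if "i < \<alpha>"
        unfolding * f(3)[OF mem] using tau_diag_less_iff(1)[of "Suc i" "Suc j" \<alpha>] mem ij(1) that by simp
      show "map (\<sigma> \<circ> f) [1..<Suc (2 * \<alpha>)] ! j < map (\<sigma> \<circ> f) [1..<Suc (2 * \<alpha>)] ! i" if "\<alpha> \<le> i"
        unfolding * f(3)[OF mem(2,1)] using tau_diag_less_iff(2)[of "Suc i" "Suc j" \<alpha>] mem ij(1) that by simp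
    qed simp
  qed
  ultimately have "card ?O \<le> card {ys. subseq ys ?L \<and> up_down \<alpha> \<alpha> ys}"
    by (rule card_inj_on_le) (rule finite_subseqs)
  then show ?thesis
    unfolding num_occ_def using card_up_down_subseqs_le[of ?L \<alpha> \<alpha>] by linarith
qed

text \<open>With all weights 1 the total weight of the one-line notation is
  \<open>n\<close>.\<close>

lemma max_occ_tau_diag_le:
  assumes "2 \<le> \<alpha>"
  shows "real (max_occ (2 * \<alpha>) (tau_diag \<alpha>) n) \<le> ((real n)\<^sup>2 / 4) ^ \<alpha> / fact \<alpha> ^ 2"
proof -
  obtain \<sigma> where \<sigma>: "\<sigma> permutes {1..n}"
      "num_occ (2 * \<alpha>) (tau_diag \<alpha>) n \<sigma> = max_occ (2 * \<alpha>) (tau_diag \<alpha>) n"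
    by (rule max_occ_attained)
  let ?L = "map \<sigma> [1..<Suc n]"
  have "distinct ?L"
    using inj_on_subset[OF permutes_inj[OF \<sigma>(1)] subset_UNIV] by (simp add: distinct_map del: upt_Suc)
  then have "up_gf \<alpha> (\<lambda>_. 1) \<alpha> ?L \<le> ((\<Sum>z\<leftarrow>?L. 1)\<^sup>2 / 4) ^ \<alpha> / fact \<alpha> ^ 2"
    by (intro up_gf_le assms) auto
  then show ?thesis
    using num_occ_tau_diag_le[OF \<sigma>(1), of \<alpha>] \<sigma>(2) by (simp add: sum_list_triv o_def del: upt_Suc)
qed

section \<open>The lower bound from the pattern \<open>tau_diag k\<close>\<close>

lemma card_Un_in_occurrences_tau_diag:
  assumes A: "A \<subseteq> {1..k}" "card A = \<alpha>" and B: "B \<subseteq> {k<..2 * k}" "card B = \<alpha>"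
  shows "A \<union> B \<in> occurrences (2 * \<alpha>) (tau_diag \<alpha>) (2 * k) (tau_diag k)"
proof -
  have fin: "finite A" "finite B" using A B by (auto intro: finite_subset[OF _ finite_atLeastAtMost] finite_subset[OF _ finite_greaterThanAtMost])
  have less: "a < b" if "a \<in> A" "b \<in> B" for a b
    using subsetD[OF A(1) that(1)] subsetD[OF B(1) that(2)] by simp
  then have disj: "A \<inter> B = {}" by blast
  let ?xs = "sorted_list_of_set A @ sorted_list_of_set B"
  define f where "f i = ?xs ! (i - 1)" for i
  have len: "length ?xs = 2 * \<alpha>" using A B by simp
  have set: "set ?xs = A \<union> B" using fin by simp
  have sorted: "sorted_wrt (<) ?xs"
    unfolding sorted_wrt_append using less fin by simp
  have mono: "f i < f j" if "1 \<le> i" "i < j" "j \<le> 2 * \<alpha>" for i j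
    unfolding f_def by (rule sorted_wrt_nth_less[OF sorted]) (use that len in auto)
  have img: "f ` {1..2 * \<alpha>} = A \<union> B"
  proof -
    have "{1..2 * \<alpha>} = Suc ` {..<2 * \<alpha>}" by (auto simp: image_iff Suc_le_eq gr0_conv_Suc)
    then have "f ` {1..2 * \<alpha>} = (!) ?xs ` {..<length ?xs}"
      by (simp only: image_image f_def diff_Suc_1 len)
    also have "\<dots> = A \<union> B"
      unfolding set[symmetric] set_conv_nth by auto
    finally show ?thesis .
  qed
  have f_range: "1 \<le> f i" "f i \<le> 2 * k" if "i \<in> {1..2 * \<alpha>}" for i
  proof -
    have "f i \<in> A \<union> B" using img that by blast
    then show "1 \<le> f i" "f i \<le> 2 * k"
      using subsetD[OF A(1), of "f i"] subsetD[OF B(1), of "f i"] by auto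
  qed
  \<comment> \<open>The increasing enumeration of \<open>A \<union> B\<close> respects halves, so
    \<open>tau_diag_less_iff\<close> gives the same answer for \<open>tau_diag k\<close> along
    \<open>f\<close> and for \<open>tau_diag \<alpha>\<close>.\<close>
  have f_le: "f i \<le> k \<longleftrightarrow> i \<le> \<alpha>" if "i \<in> {1..2 * \<alpha>}" for i
  proof (cases "i \<le> \<alpha>")
    case True
    then have "f i = sorted_list_of_set A ! (i - 1)" "i - 1 < length (sorted_list_of_set A)"
      unfolding f_def using that A by (auto simp: nth_append)
    then have "f i \<in> A" using fin(1) by (metis nth_mem sorted_list_of_set.set_sorted_key_list_of_set)
    then show ?thesis using True subsetD[OF A(1)] by simp
  next
    case False
    then have "f i = sorted_list_of_set B ! (i - 1 - \<alpha>)" "i - 1 - \<alpha> < length (sorted_list_of_set B)"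
      unfolding f_def using that A B by (auto simp: nth_append)
    then have "f i \<in> B" using fin(2) by (metis nth_mem sorted_list_of_set.set_sorted_key_list_of_set)
    then show ?thesis using False subsetD[OF B(1), of "f i"] by simp
  qed
  have iso: "tau_diag k (f i) < tau_diag k (f j) \<longleftrightarrow> tau_diag \<alpha> i < tau_diag \<alpha> j"
    if i: "i \<in> {1..2 * \<alpha>}" and j: "j \<in> {1..2 * \<alpha>}" for i j
  proof (cases i j rule: linorder_cases)
    case less
    then show ?thesis
      using tau_diag_less_iff(1)[of i j \<alpha>] tau_diag_less_iff(1)[of "f i" "f j" k]
        f_range[OF i] f_range[OF j] f_le[OF i] mono[of i j] i j by simp
  next
    case greater
    then show ?thesis
      using tau_diag_less_iff(2)[of j i \<alpha>] tau_diag_less_iff(2)[of "f j" "f i" k]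
        f_range[OF i] f_range[OF j] f_le[OF j] mono[of j i] i j by (simp add: not_le[symmetric])
  qed simp
  have "order_iso_restr (2 * \<alpha>) (tau_diag \<alpha>) (tau_diag k) (A \<union> B)"
    unfolding order_iso_restr_def using mono img iso
    by (intro exI[of _ f]) (auto simp: strict_mono_on_def)
  moreover have "card (A \<union> B) = 2 * \<alpha>"
    using card_Un_disjoint[OF fin disj] A B by simp
  moreover have "A \<union> B \<subseteq> {1..2 * k}"
    unfolding img[symmetric] using f_range by auto
  ultimately show ?thesis
    unfolding occurrences_def by simp
qed

text \<open>Any \<open>\<alpha>\<close> positions from each half of \<open>tau_diag k\<close> form
  an occurrence, and intersecting with the halves recovers the two choices.\<close>

lemma max_occ_tau_diag_ge: "(k choose \<alpha>)\<^sup>2 \<le> max_occ (2 * \<alpha>) (tau_diag \<alpha>) (2 * k)"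
proof -
  let ?P = "\<lambda>S. {A. A \<subseteq> S \<and> card A = \<alpha>}"
  let ?X = "?P {1..k} \<times> ?P {k<..2 * k}"
  have "(k choose \<alpha>)\<^sup>2 = card ?X"
    by (simp add: card_cartesian_product n_subsets power2_eq_square)
  also have "\<dots> \<le> card (occurrences (2 * \<alpha>) (tau_diag \<alpha>) (2 * k) (tau_diag k))"
  proof (rule card_inj_on_le[OF _ _ finite_occurrences])
    show "inj_on (\<lambda>(A, B). A \<union> B) ?X"
    proof (rule inj_onI, clarify)
      fix A B A' B' assume *: "A \<subseteq> {1..k}" "B \<subseteq> {k<..2 * k}" "A' \<subseteq> {1..k}" "B' \<subseteq> {k<..2 * k}" "A \<union> B = A' \<union> B'"
      have split: "S = (S \<union> T) \<inter> {1..k}" "T = (S \<union> T) \<inter> {k<..2 * k}"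
        if "S \<subseteq> {1..k}" "T \<subseteq> {k<..2 * k}" for S T
      proof -
        have "{1..k} \<inter> {k<..2 * k} = {}" by auto
        then show "S = (S \<union> T) \<inter> {1..k}" "T = (S \<union> T) \<inter> {k<..2 * k}"
          using that by blast+
      qed
      show "A = A' \<and> B = B'"
        using split[OF *(1,2)] split[OF *(3,4)] unfolding *(5) by blast
    qed
    show "(\<lambda>(A, B). A \<union> B) ` ?X \<subseteq> occurrences (2 * \<alpha>) (tau_diag \<alpha>) (2 * k) (tau_diag k)"
      using card_Un_in_occurrences_tau_diag by auto
  qed
  also have "\<dots> \<le> max_occ (2 * \<alpha>) (tau_diag \<alpha>) (2 * k)"
    using num_occ_le_max_occ[OF tau_diag_permutes] by (simp add: num_occ_def)
  finally show ?thesis .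
qed

section \<open>Passage to the limit\<close>

lemma binomial_div_power_tendsto: "(\<lambda>n. real (n choose m) / real n ^ m) \<longlonglongrightarrow> 1 / fact m"
proof (induction m)
  case (Suc m)
  have "(\<lambda>n. real m / real n) \<longlonglongrightarrow> 0" by (rule lim_const_over_n)
  then have "(\<lambda>n. real (n choose m) / real n ^ m * (1 - real m / real n) / real (Suc m))
      \<longlonglongrightarrow> 1 / fact m * (1 - 0) / real (Suc m)"
    by (intro tendsto_intros Suc) auto
  moreover have "eventually (\<lambda>n. real (n choose m) / real n ^ m * (1 - real m / real n) / real (Suc m)
      = real (n choose Suc m) / real n ^ Suc m) sequentially"
    using eventually_gt_at_top[of 0]
  proof eventually_elim
    case (elim n)
    have "(real n - real m) * real (n choose m) = real (Suc m) * real (n choose Suc m)"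
      using gbinomial_mult_1[of "real n" m] by (simp add: binomial_gbinomial algebra_simps)
    moreover have "1 - real m / real n = (real n - real m) / real n"
      using elim by (simp add: diff_divide_distrib)
    then have "real (n choose m) / real n ^ m * (1 - real m / real n) / real (Suc m)
        = (real n - real m) * real (n choose m) / (real (Suc m) * real n ^ Suc m)"
      by (simp add: mult_ac del: of_nat_Suc)
    ultimately show ?case by (simp del: of_nat_Suc power_Suc)
  qed
  ultimately show ?case by (simp add: tendsto_cong field_simps)
qed simp

theorem corollary2p2:
  fixes \<alpha> :: nat
  assumes "\<alpha> \<ge> 2"
  shows "packing_density (2 * \<alpha>) (tau_diag \<alpha>) = real ((2 * \<alpha>) choose \<alpha>) / 2 ^ (2 * \<alpha>)"
proof -
  let ?r = "packing_ratio (2 * \<alpha>) (tau_diag \<alpha>)" and ?\<rho> = "packing_density (2 * \<alpha>) (tau_diag \<alpha>)"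
  let ?q = "\<lambda>m n. real (n choose m) / real n ^ m"
  let ?c = "fact (2 * \<alpha>) / (4 ^ \<alpha> * fact \<alpha> ^ 2) :: real"
  have even: "filterlim (\<lambda>k. 2 * k :: nat) sequentially sequentially"
    by (rule filterlim_subseq) (auto simp: strict_mono_def)
  have c: "?c = real ((2 * \<alpha>) choose \<alpha>) / 2 ^ (2 * \<alpha>)"
    by (simp add: binomial_fact power2_eq_square power_mult)
  have "?\<rho> \<le> ?c"
  proof (rule LIMSEQ_le)
    show "?r \<longlonglongrightarrow> ?\<rho>" by (rule packing_ratio_tendsto)
    have "(\<lambda>n. inverse (?q (2 * \<alpha>) n) / (4 ^ \<alpha> * fact \<alpha> ^ 2)) \<longlonglongrightarrow> inverse (1 / fact (2 * \<alpha>)) / (4 ^ \<alpha> * fact \<alpha> ^ 2)"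
      by (intro tendsto_intros binomial_div_power_tendsto) auto
    then show "(\<lambda>n. inverse (?q (2 * \<alpha>) n) / (4 ^ \<alpha> * fact \<alpha> ^ 2)) \<longlonglongrightarrow> ?c" by simp
    \<comment> \<open>This holds for every \<open>n\<close>: for \<open>n < 2 * \<alpha>\<close> the
      binomial coefficient is zero and, by the convention on division by zero, so are both
      sides.\<close>
    have "?r n \<le> inverse (?q (2 * \<alpha>) n) / (4 ^ \<alpha> * fact \<alpha> ^ 2)" for n
    proof -
      have "?r n \<le> ((real n)\<^sup>2 / 4) ^ \<alpha> / fact \<alpha> ^ 2 / real (n choose (2 * \<alpha>))"
        unfolding packing_ratio_def using max_occ_tau_diag_le[OF assms] by (intro divide_right_mono) auto
      also have "((real n)\<^sup>2 / 4) ^ \<alpha> = real n ^ (2 * \<alpha>) / 4 ^ \<alpha>"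
        by (simp add: power_divide power_mult)
      finally show ?thesis by (simp add: mult.commute)
    qed
    then show "\<exists>N. \<forall>n\<ge>N. ?r n \<le> inverse (?q (2 * \<alpha>) n) / (4 ^ \<alpha> * fact \<alpha> ^ 2)" by blast
  qed
  moreover have "?c \<le> ?\<rho>"
  proof (rule LIMSEQ_le)
    \<comment> \<open>The ratios are known to converge, so the even lengths, where
      \<open>tau_diag k\<close> lives, determine the limit.\<close>
    show "(\<lambda>k. ?r (2 * k)) \<longlonglongrightarrow> ?\<rho>"
      by (rule filterlim_compose[OF packing_ratio_tendsto even])
    have "(\<lambda>k. (?q \<alpha> k)\<^sup>2 / ?q (2 * \<alpha>) (2 * k) / 4 ^ \<alpha>) \<longlonglongrightarrow> (1 / fact \<alpha>)\<^sup>2 / (1 / fact (2 * \<alpha>)) / 4 ^ \<alpha>"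
      by (intro tendsto_intros binomial_div_power_tendsto filterlim_compose[OF binomial_div_power_tendsto even]) auto
    then show "(\<lambda>k. (?q \<alpha> k)\<^sup>2 / ?q (2 * \<alpha>) (2 * k) / 4 ^ \<alpha>) \<longlonglongrightarrow> ?c"
      by (simp add: power_divide mult.commute)
    have "(?q \<alpha> k)\<^sup>2 / ?q (2 * \<alpha>) (2 * k) / 4 ^ \<alpha> \<le> ?r (2 * k)" if "1 \<le> k" for k
    proof -
      \<comment> \<open>With this identity all powers of \<open>k\<close> cancel in the quotient of
        the normalised binomials; \<open>1 \<le> k\<close> keeps them nonzero.\<close>
      have "(real k ^ \<alpha>)\<^sup>2 * 4 ^ \<alpha> = real (2 * k) ^ (2 * \<alpha>)"
      proof -
        have "(4::real) ^ \<alpha> = (2 ^ \<alpha>)\<^sup>2"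
          unfolding power_even_eq[symmetric] by (simp add: power_mult)
        then show ?thesis by (simp add: power_mult_distrib power_even_eq)
      qed
      from this[symmetric] have "(?q \<alpha> k)\<^sup>2 / ?q (2 * \<alpha>) (2 * k) / 4 ^ \<alpha> = real ((k choose \<alpha>)\<^sup>2) / real ((2 * k) choose (2 * \<alpha>))"
        using that by (simp only: power_divide) simp
      also have "\<dots> \<le> ?r (2 * k)"
        unfolding packing_ratio_def using max_occ_tau_diag_ge[of k \<alpha>] by (intro divide_right_mono) (simp_all only: of_nat_le_iff of_nat_0_le_iff)
      finally show ?thesis .
    qed
    then show "\<exists>N. \<forall>k\<ge>N. (?q \<alpha> k)\<^sup>2 / ?q (2 * \<alpha>) (2 * k) / 4 ^ \<alpha> \<le> ?r (2 * k)" by blast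
  qed
  ultimately show ?thesis unfolding c by simp
qed

end
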